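(* Let $A$ and $B$ be Banach algebras with bounded approximate identities, and let $(E^{<},E^{>})$ be a Morita equivalence between them. Let $\{J_\lambda\}_{\lambda\in\Lambda}$ and $\{I_\lambda\}_{\lambda\in\Lambda}$ be families of closed two-sided ideals of $A$ and $B$, respectively. Suppose that, for every $\lambda\in\Lambda$, $$\overline{J_\lambda E^{>}}=\overline{E^{>}I_\lambda}.$$ Then $\operatorname{Ind}_A^B(J_\lambda)=I_\lambda$ for all $\lambda\in\Lambda$. Suppose moreover that $\Lambda$ is a partially ordered set and that the assignments $\lambda\mapsto J_\lambda$ and $\lambda\mapsto I_\lambda$ are order isomorphisms from $\Lambda$ onto the two respective families (ordered by inclusion). Then Morita induction restricts to an order isomorphism between these families. If, in addition, $\Lambda$ is a lattice, the two families are sublattices of the respective lattices of closed two-sided ideals, and the parametrizations $\lambda\mapsto J_\lambda$ and $\lambda\mapsto I_\lambda$ are lattice isomorphisms, then the restricted induction map is a lattice isomorphism.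
   Context: All Banach spaces and Banach algebras are complex, and all Banach module actions are contractive. For a subset $S$ of a Banach space, $\overline{\operatorname{span}}\,S$ is its closed linear span. For sets $S,T$ a pairing symbol applied to $(S,T)$ denotes the set of all values on $S\times T$; juxtaposition of linear subspaces (e.g. $JE^{>}$, $E^{>}I$) denotes the linear span of all products, and the bar is norm closure. A bounded approximate identity in a Banach algebra $A$ is a net $(u_\lambda)$ with $\sup_\lambda\|u_\lambda\|<\infty$ and $u_\lambda a\to a$, $au_\lambda\to a$ for every $a\in A$. A Morita equivalence $(E^{<},E^{>})$ between Banach algebras $A$ and $B$ consists of a Banach $B$-$A$-bimodule $E^{<}$, a Banach $A$-$B$-bimodule $E^{>}$, and continuous bilinear pairings $\langle\cdot,\cdot\rangle_B:E^{<}\times E^{>}\to B$ and ${}_A\langle\cdot,\cdot\rangle:E^{>}\times E^{<}\to A$ of norm at most one such that, for all $e^{<},f^{<}\in E^{<}$, $e^{>},f^{>}\in E^{>}$, $a\in A$, $b\in B$: (i) $\langle be^{<},e^{>}\rangle_B=b\langle e^{<},e^{>}\rangle_B$, $\langle e^{<},e^{>}b\rangle_B=\langle e^{<},e^{>}\rangle_Bb$, ${}_A\langle ae^{>},e^{<}\rangle=a\,{}_A\langle e^{>},e^{<}\rangle$, ${}_A\langle e^{>},e^{<}a\rangle={}_A\langle e^{>},e^{<}\rangle a$; (ii) $\langle e^{<}a,e^{>}\rangle_B=\langle e^{<},ae^{>}\rangle_B$, ${}_A\langle e^{>}b,e^{<}\rangle={}_A\langle e^{>},be^{<}\rangle$;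 (iii) $\langle e^{<},e^{>}\rangle_Bf^{<}=e^{<}\,{}_A\langle e^{>},f^{<}\rangle$, $e^{>}\langle f^{<},f^{>}\rangle_B={}_A\langle e^{>},f^{<}\rangle f^{>}$; (iv) both pairings are full: $\overline{\operatorname{span}}\,\langle E^{<},E^{>}\rangle_B=B$ and $\overline{\operatorname{span}}\,{}_A\langle E^{>},E^{<}\rangle=A$; (v) all four module actions are nondegenerate, i.e. the linear span of the module products is dense in the module. For a closed two-sided ideal $J$ of $A$ put $E_J^{<}=\{\eta\in E^{<}:{}_A\langle\xi,\eta\rangle\in J\ \forall\xi\in E^{>}\}$ and $\operatorname{Ind}_A^B(J)=\overline{\operatorname{span}}\,\langle E_J^{<},E^{>}\rangle_B$, a closed two-sided ideal of $B$; "Morita induction" is the map $J\mapsto\operatorname{Ind}_A^B(J)$. *)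

theory Defs
  imports "HOL-Analysis.Analysis" "HOL-Algebra.Complete_Lattice"
begin

section \<open>Complex Banach spaces and Banach algebras\<close>

class scaleC =
  fixes scaleC :: "complex \<Rightarrow> 'a \<Rightarrow> 'a" (infixr \<open>*\<^sub>C\<close> 75)

class complex_banach = banach + scaleC +
  assumes scaleR_scaleC: "r *\<^sub>R x = complex_of_real r *\<^sub>C x"
    and scaleC_add_right: "c *\<^sub>C (x + y) = c *\<^sub>C x + c *\<^sub>C y"
    and scaleC_add_left: "(c + d) *\<^sub>C x = c *\<^sub>C x + d *\<^sub>C x"
    and scaleC_scaleC: "c *\<^sub>C d *\<^sub>C x = (c * d) *\<^sub>C x"
    and scaleC_one: "1 *\<^sub>C x = x"
    and norm_scaleC: "norm (c *\<^sub>C x) = cmod c * norm x"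

text \<open>The algebras need not have a unit; the norm is submultiplicative by
  \<^class>\<open>real_normed_algebra\<close>.\<close>

class complex_banach_algebra = complex_banach + real_normed_algebra +
  assumes mult_scaleC_left: "(c *\<^sub>C x) * y = c *\<^sub>C (x * y)"
    and mult_scaleC_right: "x * (c *\<^sub>C y) = c *\<^sub>C (x * y)"

global_interpretation complex_vector:
  vector_space "scaleC :: complex \<Rightarrow> 'a \<Rightarrow> 'a :: complex_banach"
  defines csubspace = complex_vector.subspace
    and cspan = complex_vector.span
  by unfold_locales
    (simp_all add: scaleC_add_right scaleC_add_left scaleC_scaleC scaleC_one)

text \<open>\<open>op_span f S T\<close> is the (not closed) complex linear span of the values of
  \<open>f\<close> on \<open>S \<times> T\<close>; \<open>f\<close> will be a module action or a pairing.\<close>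

definition op_span ::
    "('a \<Rightarrow> 'b \<Rightarrow> 'c::complex_banach) \<Rightarrow> 'a set \<Rightarrow> 'b set \<Rightarrow> 'c set" where
  "op_span f S T = cspan {f s t | s t. s \<in> S \<and> t \<in> T}"

definition contractive_cbilinear ::
    "('a::complex_banach \<Rightarrow> 'b::complex_banach \<Rightarrow> 'c::complex_banach) \<Rightarrow> bool" where
  "contractive_cbilinear f \<longleftrightarrow>
     bounded_bilinear f \<and>
     (\<forall>c x y. f (c *\<^sub>C x) y = c *\<^sub>C f x y) \<and>
     (\<forall>c x y. f x (c *\<^sub>C y) = c *\<^sub>C f x y) \<and>
     (\<forall>x y. norm (f x y) \<le> norm x * norm y)"


section \<open>Bounded approximate identities\<close>

definition directed_on :: "'i set \<Rightarrow> ('i \<Rightarrow> 'i \<Rightarrow> bool) \<Rightarrow> bool" where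
  "directed_on D leq \<longleftrightarrow>
     D \<noteq> {} \<and>
     (\<forall>i\<in>D. leq i i) \<and>
     (\<forall>i\<in>D. \<forall>j\<in>D. \<forall>k\<in>D. leq i j \<longrightarrow> leq j k \<longrightarrow> leq i k) \<and>
     (\<forall>i\<in>D. \<forall>j\<in>D. \<exists>k\<in>D. leq i k \<and> leq j k)"

text \<open>The filter generated by the tails of a directed set, so that convergence along
  this filter is convergence of nets.\<close>

definition tails :: "'i set \<Rightarrow> ('i \<Rightarrow> 'i \<Rightarrow> bool) \<Rightarrow> 'i filter" where
  "tails D leq = (INF i\<in>D. principal {j\<in>D. leq i j})"

definition bounded_approximate_identity ::
    "'i set \<Rightarrow> ('i \<Rightarrow> 'i \<Rightarrow> bool) \<Rightarrow> ('i \<Rightarrow> 'a::complex_banach_algebra) \<Rightarrow> bool" where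
  "bounded_approximate_identity D leq u \<longleftrightarrow>
     directed_on D leq \<and>
     bounded (u ` D) \<and>
     (\<forall>a. ((\<lambda>i. u i * a) \<longlongrightarrow> a) (tails D leq)) \<and>
     (\<forall>a. ((\<lambda>i. a * u i) \<longlongrightarrow> a) (tails D leq))"


section \<open>Banach bimodules and Morita equivalences\<close>

definition banach_bimodule ::
    "('a::complex_banach_algebra \<Rightarrow> 'e::complex_banach \<Rightarrow> 'e) \<Rightarrow>
     ('e \<Rightarrow> 'b::complex_banach_algebra \<Rightarrow> 'e) \<Rightarrow> bool" where
  "banach_bimodule l r \<longleftrightarrow>
     contractive_cbilinear l \<and> contractive_cbilinear r \<and>
     (\<forall>a a' e. l (a * a') e = l a (l a' e)) \<and>
     (\<forall>e b b'. r e (b * b') = r (r e b) b') \<and>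
     (\<forall>a e b. r (l a e) b = l a (r e b))"

text \<open>The types \<open>'a\<close>, \<open>'b\<close>, \<open>'e\<close>, \<open>'f\<close> are the algebras \<open>A\<close>, \<open>B\<close> and the modules
  \<open>E\<^sup><\<close>, \<open>E\<^sup>>\<close>. The actions of \<open>B\<close> and \<open>A\<close> on \<open>E\<^sup><\<close> are \<open>lE\<close> and \<open>rE\<close>, those of
  \<open>A\<close> and \<open>B\<close> on \<open>E\<^sup>>\<close> are \<open>lF\<close> and \<open>rF\<close>, and \<open>pB\<close>, \<open>pA\<close> are the pairings with
  values in \<open>B\<close> and \<open>A\<close>.\<close>

locale morita_equivalence =
  fixes lE :: "'b::complex_banach_algebra \<Rightarrow> 'e::complex_banach \<Rightarrow> 'e"
    and rE :: "'e \<Rightarrow> 'a::complex_banach_algebra \<Rightarrow> 'e"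
    and lF :: "'a \<Rightarrow> 'f::complex_banach \<Rightarrow> 'f"
    and rF :: "'f \<Rightarrow> 'b \<Rightarrow> 'f"
    and pB :: "'e \<Rightarrow> 'f \<Rightarrow> 'b"
    and pA :: "'f \<Rightarrow> 'e \<Rightarrow> 'a"
  assumes bimodule_E: "banach_bimodule lE rE"
    and bimodule_F: "banach_bimodule lF rF"
    and pairing_B: "contractive_cbilinear pB"
    and pairing_A: "contractive_cbilinear pA"
    and pB_left: "pB (lE b e) f = b * pB e f"
    and pB_right: "pB e (rF f b) = pB e f * b"
    and pA_left: "pA (lF a f) e = a * pA f e"
    and pA_right: "pA f (rE e a) = pA f e * a"
    and pB_balanced: "pB (rE e a) f = pB e (lF a f)"
    and pA_balanced: "pA (rF f b) e = pA f (lE b e)"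
    and compatible_E: "lE (pB e f) e' = rE e (pA f e')"
    and compatible_F: "rF f (pB e f') = lF (pA f e) f'"
    and full_B: "closure (op_span pB UNIV UNIV) = UNIV"
    and full_A: "closure (op_span pA UNIV UNIV) = UNIV"
    and nondegenerate_lE: "closure (op_span lE UNIV UNIV) = UNIV"
    and nondegenerate_rE: "closure (op_span rE UNIV UNIV) = UNIV"
    and nondegenerate_lF: "closure (op_span lF UNIV UNIV) = UNIV"
    and nondegenerate_rF: "closure (op_span rF UNIV UNIV) = UNIV"


section \<open>Closed ideals and Morita induction\<close>

definition closed_ideal :: "'a::complex_banach_algebra set \<Rightarrow> bool" where
  "closed_ideal J \<longleftrightarrow>
     csubspace J \<and> closed J \<and> (\<forall>a. \<forall>x\<in>J. a * x \<in> J \<and> x * a \<in> J)"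

definition morita_ind ::
    "('e \<Rightarrow> 'f \<Rightarrow> 'b::complex_banach_algebra) \<Rightarrow>
     ('f \<Rightarrow> 'e \<Rightarrow> 'a::complex_banach_algebra) \<Rightarrow> 'a set \<Rightarrow> 'b set" where
  "morita_ind pB pA J = closure (op_span pB {e. \<forall>f. pA f e \<in> J} UNIV)"


section \<open>Orders and lattices\<close>

definition poset_on :: "'x set \<Rightarrow> ('x \<Rightarrow> 'x \<Rightarrow> bool) \<Rightarrow> 'x gorder" where
  "poset_on X leq = \<lparr>carrier = X, eq = (=), le = leq\<rparr>"

abbreviation inclusion_poset :: "'x set set \<Rightarrow> 'x set gorder" where
  "inclusion_poset F \<equiv> poset_on F (\<subseteq>)"

definition closed_ideals :: "'a::complex_banach_algebra set gorder" where
  "closed_ideals = inclusion_poset {J. closed_ideal J}"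

definition order_isomorphism ::
    "'x gorder \<Rightarrow> 'y gorder \<Rightarrow> ('x \<Rightarrow> 'y) \<Rightarrow> bool" where
  "order_isomorphism P Q f \<longleftrightarrow>
     partial_order P \<and> partial_order Q \<and>
     bij_betw f (carrier P) (carrier Q) \<and> order_emb P Q f"

definition lattice_isomorphism ::
    "'x gorder \<Rightarrow> 'y gorder \<Rightarrow> ('x \<Rightarrow> 'y) \<Rightarrow> bool" where
  "lattice_isomorphism P Q f \<longleftrightarrow>
     bij_betw f (carrier P) (carrier Q) \<and> join_pres P Q f \<and> meet_pres P Q f"

definition sublattice :: "'x gorder \<Rightarrow> 'x set \<Rightarrow> bool" where
  "sublattice P S \<longleftrightarrow>
     S \<subseteq> carrier P \<and> (\<forall>x\<in>S. \<forall>y\<in>S. x \<squnion>\<^bsub>P\<^esub> y \<in> S \<and> x \<sqinter>\<^bsub>P\<^esub> y \<in> S)"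

lemma partial_order_inclusion_poset: "partial_order (inclusion_poset F)"
  by unfold_locales (auto simp: poset_on_def)

lemma closed_ideal_Inter:
  assumes "\<And>J. J \<in> F \<Longrightarrow> closed_ideal J"
  shows "closed_ideal (\<Inter>F)"
  using assms unfolding closed_ideal_def
  by (auto intro!: complex_vector.subspace_Inter closed_Inter)

lemma lattice_closed_ideals: "lattice (closed_ideals :: 'a::complex_banach_algebra set gorder)"
proof -
  interpret partial_order "closed_ideals :: 'a set gorder"
    unfolding closed_ideals_def by (rule partial_order_inclusion_poset)
  have "closed_ideal (UNIV :: 'a set)"
    by (simp add: closed_ideal_def)
  then have "\<exists>g. greatest closed_ideals g (carrier (closed_ideals :: 'a set gorder))"
    by (intro exI[of _ UNIV]) (auto simp: greatest_def closed_ideals_def poset_on_def)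
  moreover have "\<exists>i. greatest closed_ideals i (Lower closed_ideals F)"
    if "F \<subseteq> carrier closed_ideals" "F \<noteq> {}" for F :: "'a set set"
    using that closed_ideal_Inter[of F]
    by (intro exI[of _ "\<Inter>F"])
      (auto simp: greatest_def Lower_def closed_ideals_def poset_on_def)
  ultimately show ?thesis
    by (intro complete_lattice_lattice complete_lattice_criterion1)
qed

end

theory Submission
  imports Defs
begin

text \<open>Write \<open>E\<close>, \<open>F\<close> for \<open>E\<^sup><\<close>, \<open>E\<^sup>>\<close>. The products
  \<open>\<langle>e', f'\<rangle>\<^sub>B \<langle>e, f\<rangle>\<^sub>B = \<langle>e', \<^sub>A\<langle>f', e\<rangle> f\<rangle>\<^sub>B\<close> with \<open>e \<in> E\<^sub>J\<close> lie in \<open>\<langle>E, J F\<rangle>\<^sub>B\<close>, hence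
  in \<open>I\<close>, because \<open>J F\<close> is contained in the closure of \<open>F I\<close>; conversely
  \<open>\<langle>e, f\<rangle>\<^sub>B i = \<langle>e, f i\<rangle>\<^sub>B\<close> lies in the closed span of \<open>\<langle>e, J F\<rangle>\<^sub>B = \<langle>e J, F\<rangle>\<^sub>B\<close>, and
  \<open>e J \<subseteq> E\<^sub>J\<close>. Fullness and the approximate identity of \<open>B\<close> remove the left factor. Thus
  induction carries \<open>J\<^sub>\<lambda>\<close> to \<open>I\<^sub>\<lambda>\<close>, and it is an order or lattice isomorphism because it is
  \<open>I\<close> composed with the inverse of \<open>J\<close>.\<close>

section \<open>Closed complex subspaces and bilinear maps\<close>

lemma tendsto_scaleC:
  fixes x :: "'a::complex_banach"
  assumes "(g \<longlongrightarrow> x) F"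
  shows "((\<lambda>n. c *\<^sub>C g n) \<longlongrightarrow> c *\<^sub>C x) F"
proof -
  \<comment> \<open>Complex scaling is viewed as a bounded real-linear map, with bound
    \<open>cmod c\<close>.\<close>
  have "bounded_linear (\<lambda>x::'a. c *\<^sub>C x)"
  proof (rule bounded_linear_intro[where K = "cmod c"])
    show "c *\<^sub>C (x + y) = c *\<^sub>C x + c *\<^sub>C y" for x y :: 'a
      by (rule scaleC_add_right)
    show "c *\<^sub>C r *\<^sub>R x = r *\<^sub>R c *\<^sub>C x" for r and x :: 'a
      by (simp add: scaleR_scaleC scaleC_scaleC mult.commute)
    show "norm (c *\<^sub>C x) \<le> norm x * cmod c" for x :: 'a
      by (simp add: norm_scaleC mult.commute)
  qed
  then show ?thesis
    using assms by (rule bounded_linear.tendsto)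
qed

lemma csubspace_closure:
  fixes S :: "'a::complex_banach set"
  assumes "csubspace S"
  shows "csubspace (closure S)"
proof (rule complex_vector.subspaceI)
  show "0 \<in> closure S"
    using complex_vector.subspace_0[OF assms] closure_subset by blast
next
  fix x y assume "x \<in> closure S" "y \<in> closure S"
  then obtain g h where "\<forall>n. g n \<in> S" "g \<longlonglongrightarrow> x" "\<forall>n. h n \<in> S" "h \<longlonglongrightarrow> y"
    unfolding closure_sequential by blast
  then have "\<forall>n. g n + h n \<in> S" "(\<lambda>n. g n + h n) \<longlonglongrightarrow> x + y"
    using complex_vector.subspace_add[OF assms] by (auto intro: tendsto_add)
  then show "x + y \<in> closure S"
    unfolding closure_sequential by (intro exI[of _ "\<lambda>n. g n + h n"] conjI)
next
  fix c x assume "x \<in> closure S"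
  then obtain g where "\<forall>n. g n \<in> S" "g \<longlonglongrightarrow> x"
    unfolding closure_sequential by blast
  then have "\<forall>n. c *\<^sub>C g n \<in> S" "(\<lambda>n. c *\<^sub>C g n) \<longlonglongrightarrow> c *\<^sub>C x"
    using complex_vector.subspace_scale[OF assms] by (auto intro: tendsto_scaleC)
  then show "c *\<^sub>C x \<in> closure S"
    unfolding closure_sequential by (intro exI[of _ "\<lambda>n. c *\<^sub>C g n"] conjI)
qed

lemma csubspace_closure_op_span: "csubspace (closure (op_span f S T))"
  unfolding op_span_def by (intro csubspace_closure complex_vector.subspace_span)

lemma op_span_base: "s \<in> S \<Longrightarrow> t \<in> T \<Longrightarrow> f s t \<in> op_span f S T"
  unfolding op_span_def by (rule complex_vector.span_base) blast

lemma closure_op_span_subset: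
  assumes "csubspace V" "closed V" "\<And>s t. s \<in> S \<Longrightarrow> t \<in> T \<Longrightarrow> f s t \<in> V"
  shows "closure (op_span f S T) \<subseteq> V"
  unfolding op_span_def using assms
  by (intro closure_minimal complex_vector.span_minimal) auto

lemma csubspace_vimage:
  assumes "csubspace V" "\<And>x y. g (x + y) = g x + g y" "\<And>c x. g (c *\<^sub>C x) = c *\<^sub>C g x"
  shows "csubspace (g -` V)"
proof (rule complex_vector.subspaceI)
  have "g (0 *\<^sub>C 0) = 0 *\<^sub>C g 0"
    by (rule assms(3))
  then have "g 0 = 0"
    by simp
  then show "0 \<in> g -` V"
    using complex_vector.subspace_0[OF assms(1)] by simp
qed (use assms complex_vector.subspace_add complex_vector.subspace_scale in auto)

lemma contractive_cbilinear_mult: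
  "contractive_cbilinear ((*) :: 'a::complex_banach_algebra \<Rightarrow> 'a \<Rightarrow> 'a)"
  by (simp add: contractive_cbilinear_def bounded_bilinear_mult mult_scaleC_left
      mult_scaleC_right norm_mult_ineq)

lemma contractive_cbilinear_flip:
  "contractive_cbilinear f \<Longrightarrow> contractive_cbilinear (\<lambda>x y. f y x)"
  by (auto simp: contractive_cbilinear_def bounded_bilinear.flip mult.commute)

lemma contractive_cbilinear_closed_subspace_vimage:
  assumes f: "contractive_cbilinear f" and V: "csubspace V" "closed V"
  shows "csubspace (f x -` V)" "closed (f x -` V)"
proof -
  interpret bounded_bilinear f
    using f by (simp add: contractive_cbilinear_def)
  show "csubspace (f x -` V)"
    using f V(1) by (intro csubspace_vimage) (auto simp: contractive_cbilinear_def add_right)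
  have "continuous_on UNIV (f x)"
    by (intro continuous_on continuous_on_const continuous_on_id)
  with V(2) show "closed (f x -` V)"
    by (intro closed_vimage)
qed

text \<open>The preimage of \<open>V\<close> under \<open>f x\<close> is a closed subspace, so
  testing the generators \<open>g s t\<close> suffices. This reduces the ideal inclusions below to
  elementary products.\<close>

lemma contractive_cbilinear_closure_op_span_subset:
  assumes f: "contractive_cbilinear f" and V: "csubspace V" "closed V"
    and "\<And>s t. s \<in> S \<Longrightarrow> t \<in> T \<Longrightarrow> f x (g s t) \<in> V"
    and "y \<in> closure (op_span g S T)"
  shows "f x y \<in> V"
proof -
  have "closure (op_span g S T) \<subseteq> f x -` V"
    by (rule closure_op_span_subset)
      (use assms(4) contractive_cbilinear_closed_subspace_vimage[OF f V] in auto)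
  with assms(5) show ?thesis
    by blast
qed

section \<open>Limits along approximate identities\<close>

text \<open>Properness of the filter is what keeps limits along the net inside closed sets. It holds
  because finitely many indices have a common upper bound.\<close>

lemma tails_neq_bot:
  assumes "directed_on D leq"
  shows "tails D leq \<noteq> bot"
  unfolding tails_def
proof (rule INF_filter_not_bot)
  fix X assume "X \<subseteq> D" "finite X"
  from this(2,1) have "\<exists>k\<in>D. \<forall>i\<in>X. leq i k"
  proof (induction X rule: finite_induct)
    case empty
    then show ?case
      using assms unfolding directed_on_def by blast
  next
    case (insert i X)
    then obtain k where "k \<in> D" "\<forall>j\<in>X. leq j k"
      by auto
    moreover from this insert assms obtain m where "m \<in> D" "leq i m" "leq k m"
      unfolding directed_on_def by (meson insert_subset)
    ultimately show ?case
      using insert assms unfolding directed_on_def by (metis insert_iff insert_subset subsetD)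
  qed
  then obtain k where k: "k \<in> D" "\<forall>i\<in>X. leq i k"
    by blast
  \<comment> \<open>The upper bound \<open>k\<close> lies in every tail that starts in
    \<open>X\<close>.\<close>
  then have "(INF i\<in>X. principal {j\<in>D. leq i j}) \<ge> principal {k}"
    by (intro INF_greatest) auto
  then show "(INF i\<in>X. principal {j\<in>D. leq i j}) \<noteq> bot"
    by (metis bot.extremum_unique empty_not_insert principal_eq_bot_iff)
qed

lemma bounded_approximate_identity_mem:
  fixes u :: "'i \<Rightarrow> 'a::complex_banach_algebra" and b :: 'a
  assumes "bounded_approximate_identity D leq u" "closed V" "\<And>a. a * b \<in> V"
  shows "b \<in> V"
proof (rule Lim_in_closed_set)
  show "((\<lambda>i. u i * b) \<longlongrightarrow> b) (tails D leq)" "tails D leq \<noteq> bot"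
    using assms(1) by (auto simp: bounded_approximate_identity_def tails_neq_bot)
qed (use assms in auto)

section \<open>Induction of corresponding ideals\<close>

context morita_equivalence
begin

text \<open>By fullness the values of \<open>pB\<close> span a dense subspace of B, and right
  multiplication by \<open>b\<close> is continuous. Hence \<open>a * b\<close> lies in
  \<open>V\<close> for every \<open>a\<close>, and \<open>b\<close> is a limit of such
  products.\<close>

lemma mem_if_pB_mult_mem:
  fixes v :: "'i \<Rightarrow> 'b" and b :: 'b
  assumes "bounded_approximate_identity D leq v" "csubspace V" "closed V"
    and "\<And>e f. pB e f * b \<in> V"
  shows "b \<in> V"
proof (rule bounded_approximate_identity_mem)
  show "a * b \<in> V" for a
    \<comment> \<open>The product is flipped so that \<open>b\<close> becomes the fixed first
      argument.\<close>
    using contractive_cbilinear_closure_op_span_subset[of "\<lambda>b a. a * b" V UNIV UNIV b pB a]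
      contractive_cbilinear_flip[OF contractive_cbilinear_mult] assms full_B
    by auto
qed (use assms in auto)

lemma morita_ind_subset:
  fixes v :: "'i \<Rightarrow> 'b"
  assumes bai: "bounded_approximate_identity D leq v" and I: "closed_ideal I"
    and JI: "closure (op_span lF J UNIV) \<subseteq> closure (op_span rF UNIV I)"
  shows "morita_ind pB pA J \<subseteq> I"
  unfolding morita_ind_def
proof (rule closure_op_span_subset)
  show V: "csubspace I" "closed I"
    using I by (auto simp: closed_ideal_def)
  fix e f assume "e \<in> {e. \<forall>f. pA f e \<in> J}"
  then have e: "pA f' e \<in> J" for f'
    by blast
  show "pB e f \<in> I"
  proof (rule mem_if_pB_mult_mem[OF bai V])
    fix e' f'
    have "lF (pA f' e) f \<in> closure (op_span rF UNIV I)"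
      using op_span_base[OF e UNIV_I, of lF f' f] closure_subset JI by blast
    \<comment> \<open>On a generator, \<open>pB e' (rF f i) = pB e' f * i\<close>, which lies in the
      ideal \<open>I\<close>.\<close>
    then have "pB e' (lF (pA f' e) f) \<in> I"
      by (rule contractive_cbilinear_closure_op_span_subset[OF pairing_B V, rotated])
        (use I in \<open>auto simp: pB_right closed_ideal_def\<close>)
    then show "pB e' f' * pB e f \<in> I"
      by (simp flip: pB_right compatible_F)
  qed
qed

lemma subset_morita_ind:
  fixes v :: "'i \<Rightarrow> 'b"
  assumes bai: "bounded_approximate_identity D leq v" and J: "closed_ideal J"
    and IJ: "closure (op_span rF UNIV I) \<subseteq> closure (op_span lF J UNIV)"
  shows "I \<subseteq> morita_ind pB pA J"
proof
  fix i assume "i \<in> I"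
  have V: "csubspace (morita_ind pB pA J)" "closed (morita_ind pB pA J)"
    by (simp_all add: morita_ind_def csubspace_closure_op_span)
  show "i \<in> morita_ind pB pA J"
  proof (rule mem_if_pB_mult_mem[OF bai V])
    fix e f
    have "rF f i \<in> closure (op_span lF J UNIV)"
      using op_span_base[OF UNIV_I \<open>i \<in> I\<close>, of rF f] closure_subset IJ by blast
    then have "pB e (rF f i) \<in> morita_ind pB pA J"
    proof (rule contractive_cbilinear_closure_op_span_subset[OF pairing_B V, rotated])
      fix j f' assume "j \<in> J"
      \<comment> \<open>Here \<open>pA f (rE e j) = pA f e * j\<close>. Balancing then moves
        \<open>j\<close> across \<open>pB\<close>, which turns \<open>pB e (lF j f')\<close> into a
        generator of the induced ideal.\<close>
      then have "rE e j \<in> {e. \<forall>f. pA f e \<in> J}"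
        using J by (simp add: pA_right closed_ideal_def)
      from op_span_base[OF this UNIV_I] show "pB e (lF j f') \<in> morita_ind pB pA J"
        unfolding morita_ind_def pB_balanced[symmetric] by (rule subsetD[OF closure_subset])
    qed
    then show "pB e f * i \<in> morita_ind pB pA J"
      by (simp add: pB_right)
  qed
qed

lemma morita_ind_eq:
  fixes v :: "'i \<Rightarrow> 'b"
  assumes "bounded_approximate_identity D leq v" "closed_ideal J" "closed_ideal I"
    and "closure (op_span lF J UNIV) = closure (op_span rF UNIV I)"
  shows "morita_ind pB pA J = I"
  using assms(4)
  by (intro subset_antisym morita_ind_subset[OF assms(1,3)] subset_morita_ind[OF assms(1,2)]) auto

end

section \<open>Isomorphisms between families with a common parametrization\<close>

text \<open>On the carrier of \<open>Q\<close> the map \<open>h\<close> is \<open>g\<close> composed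
  with the inverse of \<open>f\<close>; no condition is put on \<open>h\<close> elsewhere.\<close>

lemma order_isomorphism_transport:
  assumes "order_isomorphism P Q f" "order_isomorphism P R g"
    and "\<And>x. x \<in> carrier P \<Longrightarrow> h (f x) = g x"
  shows "order_isomorphism Q R h"
proof -
  have Q: "carrier Q = f ` carrier P"
    using assms(1) by (auto simp: order_isomorphism_def bij_betw_def)
  have "bij_betw (h \<circ> f) (carrier P) (carrier R) \<longleftrightarrow> bij_betw g (carrier P) (carrier R)"
    by (rule bij_betw_cong) (simp add: assms(3))
  then have "bij_betw h (carrier Q) (carrier R)"
    using assms(1,2) by (metis bij_betw_comp_iff order_isomorphism_def)
  then show ?thesis
    using assms by (auto simp: order_isomorphism_def order_emb_def Q)
qed

lemma lattice_isomorphism_transport: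
  assumes f: "lattice_isomorphism P Q f" and g: "lattice_isomorphism P R g"
    and h: "\<And>x. x \<in> carrier P \<Longrightarrow> h (f x) = g x"
  shows "lattice_isomorphism Q R h"
proof -
  have Q: "carrier Q = f ` carrier P"
    using f by (auto simp: lattice_isomorphism_def bij_betw_def)
  have "bij_betw (h \<circ> f) (carrier P) (carrier R) \<longleftrightarrow> bij_betw g (carrier P) (carrier R)"
    by (rule bij_betw_cong) (simp add: h)
  then have bij: "bij_betw h (carrier Q) (carrier R)"
    using f g by (metis bij_betw_comp_iff lattice_isomorphism_def)
  interpret P: lattice P
    using f by (simp add: lattice_isomorphism_def join_pres_def)
  \<comment> \<open>This makes \<open>h (f z) = g z\<close> available when \<open>z\<close> is a
    join or meet: \<open>f\<close> turns the operation of \<open>Q\<close> into that of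
    \<open>P\<close>, and \<open>g\<close> carries it on to \<open>R\<close>.\<close>
  have closed: "x \<squnion>\<^bsub>P\<^esub> y \<in> carrier P" "x \<sqinter>\<^bsub>P\<^esub> y \<in> carrier P"
    if "x \<in> carrier P" "y \<in> carrier P" for x y
    using that by (auto intro: P.join_closed P.meet_closed)
  have "h (f x \<squnion>\<^bsub>Q\<^esub> f y) = h (f x) \<squnion>\<^bsub>R\<^esub> h (f y)"
    "h (f x \<sqinter>\<^bsub>Q\<^esub> f y) = h (f x) \<sqinter>\<^bsub>R\<^esub> h (f y)"
    if "x \<in> carrier P" "y \<in> carrier P" for x y
    using f g h closed that
    unfolding lattice_isomorphism_def join_pres_def meet_pres_def by metis+
  then show ?thesis
    using f g bij by (auto simp: lattice_isomorphism_def join_pres_def meet_pres_def Q)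
qed

theorem corollary4p2:
  fixes lE :: "'b::complex_banach_algebra \<Rightarrow> 'e::complex_banach \<Rightarrow> 'e"
    and rE :: "'e \<Rightarrow> 'a::complex_banach_algebra \<Rightarrow> 'e"
    and lF :: "'a \<Rightarrow> 'f::complex_banach \<Rightarrow> 'f"
    and rF :: "'f \<Rightarrow> 'b \<Rightarrow> 'f"
    and pB :: "'e \<Rightarrow> 'f \<Rightarrow> 'b"
    and pA :: "'f \<Rightarrow> 'e \<Rightarrow> 'a"
    and DA :: "'i set" and leA :: "'i \<Rightarrow> 'i \<Rightarrow> bool" and u :: "'i \<Rightarrow> 'a"
    and DB :: "'j set" and leB :: "'j \<Rightarrow> 'j \<Rightarrow> bool" and v :: "'j \<Rightarrow> 'b"
    and \<Lambda> :: "'l set" and le\<Lambda> :: "'l \<Rightarrow> 'l \<Rightarrow> bool"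
    and J :: "'l \<Rightarrow> 'a set" and I :: "'l \<Rightarrow> 'b set"
  assumes "bounded_approximate_identity DA leA u"
    and "bounded_approximate_identity DB leB v"
    and "morita_equivalence lE rE lF rF pB pA"
    and "\<And>l. l \<in> \<Lambda> \<Longrightarrow> closed_ideal (J l)"
    and "\<And>l. l \<in> \<Lambda> \<Longrightarrow> closed_ideal (I l)"
    and "\<And>l. l \<in> \<Lambda> \<Longrightarrow> closure (op_span lF (J l) UNIV) = closure (op_span rF UNIV (I l))"
  shows "(\<forall>l\<in>\<Lambda>. morita_ind pB pA (J l) = I l) \<and>
    (partial_order (poset_on \<Lambda> le\<Lambda>) \<and>
     order_isomorphism (poset_on \<Lambda> le\<Lambda>) (inclusion_poset (J ` \<Lambda>)) J \<and>
     order_isomorphism (poset_on \<Lambda> le\<Lambda>) (inclusion_poset (I ` \<Lambda>)) I \<longrightarrow>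
       order_isomorphism (inclusion_poset (J ` \<Lambda>)) (inclusion_poset (I ` \<Lambda>)) (morita_ind pB pA) \<and>
       (lattice (poset_on \<Lambda> le\<Lambda>) \<and>
        sublattice closed_ideals (J ` \<Lambda>) \<and>
        sublattice closed_ideals (I ` \<Lambda>) \<and>
        lattice_isomorphism (poset_on \<Lambda> le\<Lambda>) (inclusion_poset (J ` \<Lambda>)) J \<and>
        lattice_isomorphism (poset_on \<Lambda> le\<Lambda>) (inclusion_poset (I ` \<Lambda>)) I \<longrightarrow>
          lattice_isomorphism (inclusion_poset (J ` \<Lambda>)) (inclusion_poset (I ` \<Lambda>))
            (morita_ind pB pA)))"
proof -
  interpret morita_equivalence lE rE lF rF pB pA
    by (rule assms(3))
  have ind: "morita_ind pB pA (J l) = I l" if "l \<in> \<Lambda>" for l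
    by (rule morita_ind_eq[OF assms(2) assms(4-6)[OF that]])
  then have "morita_ind pB pA (J l) = I l" if "l \<in> carrier (poset_on \<Lambda> le\<Lambda>)" for l
    using that by (simp add: poset_on_def)
  \<comment> \<open>Transport applies with \<open>f = J\<close>, \<open>g = I\<close> and
    \<open>h = morita_ind pB pA\<close>.\<close>
  with ind show ?thesis
    by (meson order_isomorphism_transport lattice_isomorphism_transport)
qed

end
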